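(* Let $n > m \geq 1$ be integers and let $f : \mathbb{R}^n \rightarrow \mathbb{R}^m$ be a continuous map. Then for any real $M > 0$, there exists $y \in \mathbb{R}^m$ such that the fiber $f^{-1}(y)$ has diameter greater than $M$.
   Context: The fibers of a map $f : X \to Y$ are the preimages $f^{-1}(y) = \{x \in X : f(x) = y\}$ of points $y \in Y$. The diameter of a set $A \subseteq \mathbb{R}^n$ is the supremum $\sup\{d(x,y) : x, y \in A\}$ (possibly $+\infty$), where $d(x,y)$ denotes the Euclidean distance between $x$ and $y$. *)

theory Defs
  imports "HOL-Analysis.Analysis"
begin

(* The library's real-valued diameter is a conditional supremum, hence unspecified on unbounded
   sets; here the supremum is taken in [0, \<infinity>]. The supremum of no distances is 0, so the empty set
   has diameter 0, as for the library's diameter. *)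
definition ediameter :: "'a::metric_space set \<Rightarrow> ennreal" where
  "ediameter A = Sup {ennreal (dist x y) | x y. x \<in> A \<and> y \<in> A}"

lemma ediameter_bounded:
  assumes "bounded A"
  shows "ediameter A = ennreal (diameter A)"
proof (cases "A = {}")
  case True
  then show ?thesis by (simp add: ediameter_def bot_ennreal)
next
  case False
  show ?thesis
  proof (rule antisym)
    show "ediameter A \<le> ennreal (diameter A)"
      unfolding ediameter_def
      by (rule Sup_least) (auto intro!: ennreal_leI diameter_bounded_bound assms)
    show "ennreal (diameter A) \<le> ediameter A"
    proof (cases "ediameter A")
      case (real r)
      have "dist x y \<le> r" if "x \<in> A" "y \<in> A" for x y
      proof -
        have "ennreal (dist x y) \<le> ediameter A"
          unfolding ediameter_def by (rule Sup_upper) (use that in auto)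
        then show ?thesis using real by simp
      qed
      then have "diameter A \<le> r"
        using False by (auto simp: diameter_def intro!: cSUP_least)
      then show ?thesis using real by (simp add: ennreal_leI)
    qed simp
  qed
qed

end

theory Submission
  imports Defs
begin

text \<open>
  Suppose that every fiber of \<open>f\<close> on a ball of radius \<open>R > M\<close> has diameter at most \<open>M\<close>. A partition of
  unity on the image yields a continuous \<open>g\<close> such that \<open>g \<circ> f\<close> moves every point of the ball by less
  than \<open>R\<close>, and by Weierstrass \<open>g\<close> may be taken to be a polynomial map. Brouwer's theorem then shows
  that the image of \<open>g \<circ> f\<close> contains a smaller ball, whereas the image of the polynomial map \<open>g\<close> is
  negligible because it raises the dimension.
\<close>

text \<open>Pairs of points of \<open>K\<close> at distance at least \<open>D\<close> form a compact
  set on which the distance of the images is continuous and, by \<open>small\<close>, never zero.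
  Its minimum there serves as \<open>d\<close>.\<close>

lemma uniformly_small_fibers:
  fixes f :: "'a::metric_space \<Rightarrow> 'b::metric_space"
  assumes K: "compact K" and f: "continuous_on K f"
    and small: "\<And>x y. \<lbrakk>x \<in> K; y \<in> K; f x = f y\<rbrakk> \<Longrightarrow> dist x y < D"
  obtains d where "d > 0" "\<And>x y. \<lbrakk>x \<in> K; y \<in> K; dist (f x) (f y) < d\<rbrakk> \<Longrightarrow> dist x y < D"
proof -
  define P where "P = (K \<times> K) \<inter> {p. D \<le> dist (fst p) (snd p)}"
  have "closed {p::'a \<times> 'a. D \<le> dist (fst p) (snd p)}"
    by (intro closed_Collect_le continuous_intros)
  then have P: "compact P"
    unfolding P_def by (intro compact_Int_closed compact_Times K)
  show thesis
  proof (cases "P = {}")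
    case True
    \<comment> \<open>No two points of \<open>K\<close> are \<open>D\<close> apart, so any positive
      number will do.\<close>
    then show thesis
      by (intro that[of 1]) (auto simp: P_def not_le[symmetric])
  next
    case False
    have "continuous_on P (\<lambda>p. dist (f (fst p)) (f (snd p)))"
      by (intro continuous_intros continuous_on_compose2[OF f]) (auto simp: P_def)
    from continuous_attains_inf[OF P False this] obtain p where p: "p \<in> P"
      "\<And>q. q \<in> P \<Longrightarrow> dist (f (fst p)) (f (snd p)) \<le> dist (f (fst q)) (f (snd q))"
      by blast
    show thesis
    proof (rule that)
      show "0 < dist (f (fst p)) (f (snd p))"
        using p(1) small[of "fst p" "snd p"] by (force simp: P_def)
      show "dist x y < D"
        if "x \<in> K" "y \<in> K" "dist (f x) (f y) < dist (f (fst p)) (f (snd p))" for x y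
        using p(2)[of "(x, y)"] that by (force simp: P_def)
    qed
  qed
qed

text \<open>\<open>g y\<close> averages finitely many points \<open>c\<close> of \<open>K\<close>,
  giving weight only to those with \<open>f c\<close> near \<open>y\<close>. At
  \<open>y = f x\<close> these all lie within \<open>D\<close> of \<open>x\<close>, hence so does
  their average.\<close>

lemma approximate_left_inverse:
  fixes f :: "'a::euclidean_space \<Rightarrow> 'b::metric_space"
  assumes K: "compact K" and f: "continuous_on K f"
    and small: "\<And>x y. \<lbrakk>x \<in> K; y \<in> K; f x = f y\<rbrakk> \<Longrightarrow> dist x y < D"
  obtains g where "continuous_on (f ` K) g" "\<And>x. x \<in> K \<Longrightarrow> norm (x - g (f x)) \<le> D"
proof -
  obtain d where d: "d > 0" "\<And>x y. \<lbrakk>x \<in> K; y \<in> K; dist (f x) (f y) < d\<rbrakk> \<Longrightarrow> dist x y < D"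
    using uniformly_small_fibers[OF K f small] by blast
  have "compact (f ` K)"
    by (rule compact_continuous_image[OF f K])
  then obtain C where C: "C \<subseteq> K" "finite C" "f ` K \<subseteq> (\<Union>c\<in>C. ball (f c) d)"
    by (rule compactE_image[of _ K "\<lambda>c. ball (f c) d"]) (use d in force)+
  define w where "w c y = max 0 (d - dist (f c) y)" for c y
  define W where "W y = (\<Sum>c\<in>C. w c y)" for y
  have w: "0 \<le> w c y" for c y
    by (simp add: w_def)
  have W: "0 < W y" if y: "y \<in> f ` K" for y
  proof -
    obtain c where "c \<in> C" "dist (f c) y < d"
      using subsetD[OF C(3) y] by auto
    then show ?thesis
      unfolding W_def by (intro sum_pos2[OF C(2), of c] w) (auto simp: w_def)
  qed
  show thesis
  proof (rule that)
    show "continuous_on (f ` K) (\<lambda>y. (1 / W y) *\<^sub>R (\<Sum>c\<in>C. w c y *\<^sub>R c))"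
      using W unfolding W_def w_def by (intro continuous_intros) fastforce
    show "norm (x - (1 / W (f x)) *\<^sub>R (\<Sum>c\<in>C. w c (f x) *\<^sub>R c)) \<le> D" if x: "x \<in> K" for x
    proof -
      have pos: "0 < W (f x)"
        using W x by blast
      \<comment> \<open>The normalized weights sum to 1, so the error is the same average taken over
        the differences \<open>x - c\<close>.\<close>
      have "x - (1 / W (f x)) *\<^sub>R (\<Sum>c\<in>C. w c (f x) *\<^sub>R c)
          = (1 / W (f x)) *\<^sub>R (W (f x) *\<^sub>R x - (\<Sum>c\<in>C. w c (f x) *\<^sub>R c))"
        using pos by (simp add: scaleR_diff_right)
      also have "W (f x) *\<^sub>R x - (\<Sum>c\<in>C. w c (f x) *\<^sub>R c) = (\<Sum>c\<in>C. w c (f x) *\<^sub>R (x - c))"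
        by (simp add: W_def scaleR_sum_left sum_subtractf scaleR_diff_right)
      finally have eq: "norm (x - (1 / W (f x)) *\<^sub>R (\<Sum>c\<in>C. w c (f x) *\<^sub>R c))
          = norm (\<Sum>c\<in>C. w c (f x) *\<^sub>R (x - c)) / W (f x)"
        using pos by simp
      \<comment> \<open>Either \<open>f c\<close> is within \<open>d\<close> of \<open>f x\<close>,
        which forces \<open>c\<close> close to \<open>x\<close>, or the weight vanishes.\<close>
      have "norm (w c (f x) *\<^sub>R (x - c)) \<le> w c (f x) * D" if "c \<in> C" for c
      proof (cases "dist (f c) (f x) < d")
        case True
        then have "dist c x < D"
          using d(2) C(1) that x by blast
        then show ?thesis
          using w by (simp add: dist_norm norm_minus_commute mult_left_mono)
      qed (simp add: w_def)
      then have "norm (\<Sum>c\<in>C. w c (f x) *\<^sub>R (x - c)) \<le> (\<Sum>c\<in>C. w c (f x) * D)"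
        by (rule sum_norm_le)
      also have "\<dots> = D * W (f x)"
        by (simp add: W_def sum_distrib_left mult.commute)
      finally show ?thesis
        unfolding eq using pos by (simp add: divide_le_eq)
    qed
  qed
qed

text \<open>Working on a closed ball supplies the compactness that the approximations require; a
  radius beyond \<open>M\<close> leaves room for their errors.\<close>

theorem large_fiber_on_cball:
  fixes f :: "'a::euclidean_space \<Rightarrow> 'b::euclidean_space"
  assumes dim: "DIM('b) < DIM('a)" and f: "continuous_on (cball a R) f"
    and M: "0 \<le> M" "M < R"
  obtains x y where "x \<in> cball a R" "y \<in> cball a R" "f x = f y" "M < dist x y"
proof (rule ccontr)
  assume "\<not> thesis"
  let ?K = "cball a R"
  from \<open>\<not> thesis\<close> that have no: "dist x y \<le> M" if "x \<in> ?K" "y \<in> ?K" "f x = f y" for x y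
    using that by (meson not_le)
  \<comment> \<open>The gap is spent in three equal shares: the strict bound on the fibers, the
    polynomial approximation, and the radius of the ball to be covered.\<close>
  define e where "e = (R - M) / 3"
  have e: "e > 0" "M + 3 * e = R"
    using M by (auto simp: e_def field_simps)
  have "dist x y < M + e" if "x \<in> ?K" "y \<in> ?K" "f x = f y" for x y
    using no[OF that] e(1) by simp
  from approximate_left_inverse[OF compact_cball f this] obtain g where
    g: "continuous_on (f ` ?K) g" "\<And>x. x \<in> ?K \<Longrightarrow> norm (x - g (f x)) \<le> M + e"
    by blast
  \<comment> \<open>A merely continuous map may raise dimension and still fill a ball, as
    space-filling curves do; differentiability of \<open>p\<close> rules this out.\<close>
  obtain p where p: "polynomial_function p" "\<forall>y\<in>f ` ?K. norm (g y - p y) < e"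
    using Stone_Weierstrass_polynomial_function[OF compact_continuous_image[OF f compact_cball] g(1) e(1)]
    by blast
  have close: "norm (x - p (f x)) \<le> M + 2 * e" if "x \<in> ?K" for x
    using norm_triangle_ineq[of "x - g (f x)" "g (f x) - p (f x)"] g(2)[OF that]
      bspec[OF p(2) imageI[OF that]] by simp
  have "ball a e \<subseteq> range p"
  proof
    fix z assume z: "z \<in> ball a e"
    have "\<exists>x\<in>?K. (p \<circ> f) x = z"
    proof (rule brouwer_surjective_cball)
      show "continuous_on ?K (p \<circ> f)"
        by (intro continuous_on_compose f continuous_on_polymonial_function p)
      \<comment> \<open>This map sends \<open>?K\<close> into itself because
        \<open>e + (M + 2 * e) = R\<close>; at a fixed point \<open>x\<close> of it,
        \<open>p (f x) = z'\<close>.\<close>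
      show "z' + (x - (p \<circ> f) x) \<in> ?K" if "z' \<in> ball a e" "x \<in> ?K" for z' x
        using norm_triangle_ineq[of "z' - a" "x - p (f x)"] close[OF that(2)] that(1) e
        by (simp add: dist_norm norm_minus_commute algebra_simps)
      show "R > 0" using M by simp
    qed (fact z)
    then show "z \<in> range p" by auto
  qed
  moreover have "negligible (range p)"
    by (rule negligible_differentiable_image_lowdim[OF dim differentiable_on_polynomial_function[OF p(1)]])
  ultimately have "negligible (ball a e)"
    by (rule negligible_subset[rotated])
  then show False
    using open_not_negligible[of "ball a e"] e(1) by simp
qed

theorem theorem1:
  fixes f :: "real ^ 'n \<Rightarrow> real ^ 'm" and M :: real
  assumes "CARD('n) > CARD('m)" and "CARD('m) \<ge> 1"
    and "continuous_on UNIV f"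
    and "M > 0"
  shows "\<exists>y. ediameter (f -` {y}) > ennreal M"
proof -
  \<comment> \<open>Any center and any radius above \<open>M\<close> would serve.\<close>
  have cont: "continuous_on (cball 0 (M + 1)) f"
    using assms(3) continuous_on_subset by blast
  have dim: "DIM(real ^ 'm) < DIM(real ^ 'n)"
    using assms(1) by simp
  obtain x y where xy: "f x = f y" "M < dist x y"
    by (rule large_fiber_on_cball[OF dim cont, of M]) (use assms(4) in auto)
  have "ennreal M < ennreal (dist x y)"
    using xy(2) assms(4) by (simp add: ennreal_less_iff)
  also have "\<dots> \<le> ediameter (f -` {f y})"
    unfolding ediameter_def by (rule Sup_upper) (use xy(1) in auto)
  finally show ?thesis by blast
qed

end
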